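(* Assume that $f_{\mathcal H}$ is $L$-smooth, that the honest local objectives satisfy the $(G,B)$-bounded dissimilarity condition, that the stochastic gradients satisfy the stochastic first-order oracle assumption with variance bound $\sigma^2$, and that the aggregation rule $\mathcal A$ is $(b,\kappa)$-robust. Let $0<\delta<1/4$ be a fixed constant and assume $\kappa B^2<\frac{1-4\delta}{1+2\delta}$. For any integer $T\ge1$, let the stepsizes be $\gamma_t\equiv\gamma=\gamma_0/\sqrt T$, where $0<\gamma_0\le\delta/L$. Then the iterates $\{x^t\}_{t=0}^{T-1}$ generated by R-DSGD satisfy $$\frac1T\sum_{t=0}^{T-1}\mathbb E\left[\|\nabla f_{\mathcal H}(x^t)\|^2\right]\le C\left(\frac{\Delta_0+\sigma^2}{(1-\kappa B^2)\sqrt T}+\frac{\kappa G^2}{1-\kappa B^2}+\frac{\kappa\sigma^2}{1-\kappa B^2}\right),$$ where $\Delta_0=f_{\mathcal H}(x^0)-f_{\mathcal H}^*$ and $C$ is a constant depending only on $L$, $\delta$ and $\gamma_0$.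
   Context: Setting. There are $n$ workers and a central server; $b<n/2$ workers may be Byzantine. $\mathcal H\subset[n]=\{1,\dots,n\}$ is the set of honest workers, $|\mathcal H|=h=n-b$. Worker $i$ has data distribution $\mathcal D_i$ and, for a loss $\ell$, differentiable local objective $f_i(x)=\mathbb E_{\xi_i\sim\mathcal D_i}[\ell(x,\xi_i)]$, $x\in\mathbb R^d$. The global objective is $f_{\mathcal H}=\frac1h\sum_{i\in\mathcal H}f_i$, and $f_{\mathcal H}^*=\inf_{x\in\mathbb R^d}f_{\mathcal H}(x)>-\infty$. $\|\cdot\|$ is the Euclidean norm and $\mathbb E$ the total expectation. R-DSGD (robust distributed SGD). Given a deterministic $x^0\in\mathbb R^d$, stepsizes $\gamma_t>0$ and an aggregation rule $\mathcal A:\mathbb R^{d\times n}\to\mathbb R^d$: for $t=1,2,\dots$, each honest worker $i\in\mathcal H$ sends a stochastic gradient $g_i^t=g_i(x^{t-1},\xi_i^t)$, where $\xi_i^t\sim\mathcal D_i$ is drawn afresh (independently of the past); each Byzantine worker $j$ sends an arbitrary vector $g_j^t\in\mathbb R^d$; the server sets $x^t=x^{t-1}-\gamma_t\,\mathcal A(g_1^t,\dots,g_n^t)$. $L$-smoothness: $f_{\mathcal H}$ is differentiable and $\nabla f_{\mathcal H}$ is Lipschitz continuous with constant $L>0$. $(G,B)$-bounded dissimilarity ($G,B\ge0$): $\frac1h\sum_{i\in\mathcal H}\|\nabla f_i(x)-\nabla f_{\mathcal H}(x)\|^2\le G^2+B^2\|\nabla f_{\mathcal H}(x)\|^2$ for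 all $x\in\mathbb R^d$. Stochastic first-order oracle: for each $i\in\mathcal H$ and all $x$, $\mathbb E_{\xi_i\sim\mathcal D_i}[g_i(x,\xi_i)]=\nabla f_i(x)$ and $\mathbb E_{\xi_i\sim\mathcal D_i}[\|g_i(x,\xi_i)-\nabla f_i(x)\|^2]\le\sigma^2$; the stochastic gradients of different workers are mutually independent. $(b,\kappa)$-robustness ($\kappa>0$, $b<n/2$): for all $x_1,\dots,x_n\in\mathbb R^d$ and every $S\subset[n]$ with $|S|=n-b$, $\|\mathcal A(x_1,\dots,x_n)-\bar x_S\|^2\le\frac{\kappa}{n-b}\sum_{i\in S}\|x_i-\bar x_S\|^2$, where $\bar x_S=\frac1{n-b}\sum_{i\in S}x_i$. *)

theory Defs
  imports "HOL-Probability.Probability"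
begin

text \<open>
  The \<open>n\<close> workers are the elements of a finite type \<open>'n\<close>, so \<open>n = CARD('n)\<close>, and a tuple of
  \<open>n\<close> vectors in \<open>R^d\<close>, i.e. an element of \<open>R^(d x n)\<close>, has type \<open>real^'d^'n\<close>; its \<open>i\<close>-th vector
  is \<open>X $ i\<close>.
\<close>

definition average :: "'i set \<Rightarrow> ('i \<Rightarrow> 'v::real_vector) \<Rightarrow> 'v" where
  "average S v = (1 / real (card S)) *\<^sub>R (\<Sum>i\<in>S. v i)"

text \<open>Meaningful only where \<open>f\<close> is differentiable; the gradient is then unique.\<close>

definition gradient :: "('a::real_inner \<Rightarrow> real) \<Rightarrow> 'a \<Rightarrow> 'a" where
  "gradient f x = (THE v. GDERIV f x :> v)"

definition local_objective :: "('a \<Rightarrow> 'z \<Rightarrow> real) \<Rightarrow> 'z measure \<Rightarrow> 'a \<Rightarrow> real" where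
  "local_objective l P x = (\<integral>z. l x z \<partial>P)"

definition global_objective :: "('a \<Rightarrow> 'z \<Rightarrow> real) \<Rightarrow> ('n \<Rightarrow> 'z measure) \<Rightarrow> 'n set \<Rightarrow> 'a \<Rightarrow> real" where
  "global_objective l D H x = average H (\<lambda>i. local_objective l (D i) x)"

definition L_smooth :: "real \<Rightarrow> ('a::real_inner \<Rightarrow> real) \<Rightarrow> bool" where
  "L_smooth L f \<longleftrightarrow>
     0 < L \<and> (\<forall>x. f differentiable (at x)) \<and> L-lipschitz_on UNIV (gradient f)"

definition bounded_dissimilarity ::
  "real \<Rightarrow> real \<Rightarrow> 'n set \<Rightarrow> ('n \<Rightarrow> 'a::real_inner \<Rightarrow> real) \<Rightarrow> ('a \<Rightarrow> real) \<Rightarrow> bool" where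
  "bounded_dissimilarity G B H f fH \<longleftrightarrow> 0 \<le> G \<and> 0 \<le> B \<and>
     (\<forall>x. average H (\<lambda>i. (norm (gradient (f i) x - gradient fH x))\<^sup>2)
            \<le> G\<^sup>2 + B\<^sup>2 * (norm (gradient fH x))\<^sup>2)"

text \<open>
  \<open>\<xi> t i\<close> is the sample that worker \<open>i\<close> draws in round \<open>t\<close>, a random variable on \<open>M\<close>; rounds are
  \<open>t = 1, 2, ...\<close>. Independence across workers is required of the stochastic gradients at each fixed
  point \<open>x\<close>. It could not be required of the gradients at the random iterates, which all depend on
  the same iterate. The Bochner integral of a non-integrable function is \<open>0\<close>, hence the explicit
  integrability requirements.
\<close>

definition stochastic_first_order_oracle ::
  "'w measure \<Rightarrow> 'n set \<Rightarrow> ('n \<Rightarrow> 'z measure) \<Rightarrow> (nat \<Rightarrow> 'n \<Rightarrow> 'w \<Rightarrow> 'z) \<Rightarrow>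
   ('n \<Rightarrow> 'a::euclidean_space \<Rightarrow> real) \<Rightarrow> ('n \<Rightarrow> 'a \<Rightarrow> 'z \<Rightarrow> 'a) \<Rightarrow> real \<Rightarrow> bool" where
  "stochastic_first_order_oracle M H D \<xi> f g \<sigma> \<longleftrightarrow>
     (\<forall>i\<in>H. (\<lambda>(x, z). g i x z) \<in> borel_measurable (borel \<Otimes>\<^sub>M D i)) \<and>
     (\<forall>i\<in>H. \<forall>x. integrable (D i) (g i x) \<and> (\<integral>z. g i x z \<partial>D i) = gradient (f i) x) \<and>
     (\<forall>i\<in>H. \<forall>x. integrable (D i) (\<lambda>z. (norm (g i x z - gradient (f i) x))\<^sup>2) \<and>
        (\<integral>z. (norm (g i x z - gradient (f i) x))\<^sup>2 \<partial>D i) \<le> \<sigma>\<^sup>2) \<and>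
     (\<forall>t\<ge>1. \<forall>x. prob_space.indep_vars M (\<lambda>_. borel) (\<lambda>i \<omega>. g i x (\<xi> t i \<omega>)) H)"

definition robust_aggregation :: "nat \<Rightarrow> real \<Rightarrow> (real^'d^'n \<Rightarrow> real^'d) \<Rightarrow> bool" where
  "robust_aggregation b \<kappa> \<A> \<longleftrightarrow> 2 * b < CARD('n) \<and> 0 < \<kappa> \<and>
     (\<forall>X :: real^'d^'n. \<forall>S :: 'n set. card S = CARD('n) - b \<longrightarrow>
        (norm (\<A> X - average S (($) X)))\<^sup>2
          \<le> \<kappa> / real (CARD('n) - b) * (\<Sum>i\<in>S. (norm (X $ i - average S (($) X)))\<^sup>2))"

text \<open>
  A run of robust distributed SGD. The \<open>\<sigma>\<close>-algebra \<open>F t\<close> is the past up to and including round \<open>t\<close>.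
  \<open>m t \<omega>\<close> is the tuple of vectors received by the server in round \<open>t\<close>: its components outside the
  honest set \<open>H\<close> are unconstrained and may depend on everything that happened up to round \<open>t\<close>,
  including the honest messages of that round. They and \<open>\<A>\<close> need not be measurable, as long as the
  resulting iterates are random vectors determined by the past. In \<open>fresh\<close>, the samples of all honest
  workers in a round are jointly independent of the past.
\<close>

locale r_dsgd = prob_space M + filtration "space M" F
  for M :: "'w measure" and F :: "nat \<Rightarrow> 'w measure" +
  fixes H :: "'n::finite set"
    and D :: "'n \<Rightarrow> 'z measure"
    and \<xi> :: "nat \<Rightarrow> 'n \<Rightarrow> 'w \<Rightarrow> 'z"
    and g :: "'n \<Rightarrow> real^'d \<Rightarrow> 'z \<Rightarrow> real^'d"
    and \<A> :: "real^'d^'n \<Rightarrow> real^'d"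
    and \<gamma> :: "nat \<Rightarrow> real"
    and x0 :: "real^'d"
    and m :: "nat \<Rightarrow> 'w \<Rightarrow> real^'d^'n"
    and x :: "nat \<Rightarrow> 'w \<Rightarrow> real^'d"
  assumes past_events: "\<And>t. sets (F t) \<subseteq> sets M"
    and sample_adapted: "\<And>t i. t \<ge> 1 \<Longrightarrow> i \<in> H \<Longrightarrow> \<xi> t i \<in> F t \<rightarrow>\<^sub>M D i"
    and sample_law: "\<And>t i. t \<ge> 1 \<Longrightarrow> i \<in> H \<Longrightarrow> distr M (D i) (\<xi> t i) = D i"
    and fresh: "\<And>t. t \<ge> 1 \<Longrightarrow>
      indep_set (sets (F (t - 1)))
        (sets (vimage_algebra (space M) (\<lambda>\<omega>. \<lambda>i\<in>H. \<xi> t i \<omega>) (Pi\<^sub>M H D)))"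
    and stepsize_pos: "\<And>t. t \<ge> 1 \<Longrightarrow> 0 < \<gamma> t"
    and initial: "\<And>\<omega>. \<omega> \<in> space M \<Longrightarrow> x 0 \<omega> = x0"
    and honest_message: "\<And>t i \<omega>. t \<ge> 1 \<Longrightarrow> i \<in> H \<Longrightarrow> \<omega> \<in> space M \<Longrightarrow>
      m t \<omega> $ i = g i (x (t - 1) \<omega>) (\<xi> t i \<omega>)"
    and server_update: "\<And>t \<omega>. t \<ge> 1 \<Longrightarrow> \<omega> \<in> space M \<Longrightarrow>
      x t \<omega> = x (t - 1) \<omega> - \<gamma> t *\<^sub>R \<A> (m t \<omega>)"
    and iterate_adapted: "\<And>t. x t \<in> borel_measurable (F t)"

text \<open>
  An explicit constant that depends on \<open>L\<close>, \<open>\<delta>\<close> and \<open>\<gamma>\<^sub>0\<close> only. A constant bound by an existential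
  quantifier inside a theorem could still depend on the types of the theorem, i.e. on the dimension,
  the number of workers and the sample spaces. The value comes from the descent lemma: the
  coefficient of \<open>(norm (gradient fH x))\<^sup>2\<close> is at least
  \<open>\<gamma> / 2 * ((1 - \<kappa> * B\<^sup>2) - 2 * \<delta> * (1 + \<kappa> * B\<^sup>2)) \<ge> \<gamma> / 2 * (1 + 2 * \<delta>) / 3 * (1 - \<kappa> * B\<^sup>2)\<close>.
  Dividing by it leaves the factors \<open>6 / ((1 + 2 * \<delta>) * \<gamma>\<^sub>0)\<close> for the initial gap,
  \<open>6 * L * \<gamma>\<^sub>0 / (1 + 2 * \<delta>)\<close> for the noise, and \<open>6 * (1 / 2 + \<delta>) / (1 + 2 * \<delta>) = 3\<close> for the
  two terms with \<open>\<kappa>\<close>.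
\<close>

definition rate_constant :: "real \<Rightarrow> real \<Rightarrow> real \<Rightarrow> real" where
  "rate_constant L \<delta> \<gamma>\<^sub>0 = max 3 (6 / (1 + 2 * \<delta>) * max (1 / \<gamma>\<^sub>0) (L * \<gamma>\<^sub>0))"

end

theory Submission
  imports Defs
begin

text \<open>
  Write \<open>f\<close> for the global objective, \<open>q\<close> for its gradient at the current iterate, \<open>a\<^sub>i\<close> for the
  honest local gradients there, \<open>n\<^sub>i\<close> for the zero-mean noise in the message \<open>a\<^sub>i + n\<^sub>i\<close> of the honest
  worker \<open>i\<close>, and \<open>r\<close> for the aggregated vector. The descent lemma for \<open>L\<close>-smooth functions bounds the
  new value of \<open>f\<close> by the old one minus \<open>\<gamma> (r \<bullet> q)\<close> plus \<open>L \<gamma>\<^sup>2 \<parallel>r\<parallel>\<^sup>2 / 2\<close>. Split \<open>r\<close> into the honest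
  mean and the aggregation error \<open>s\<close>. Robustness controls \<open>\<parallel>s\<parallel>\<^sup>2\<close> by \<open>\<kappa>\<close> times the empirical variance
  of the honest messages, which is at most the dissimilarity \<open>G\<^sup>2 + B\<^sup>2 \<parallel>q\<parallel>\<^sup>2\<close> plus the mean of the
  \<open>\<parallel>n\<^sub>i\<parallel>\<^sup>2\<close> plus terms linear in the noise. The aggregation error is correlated with everything else, so
  \<open>-(s \<bullet> q)\<close> is bounded by \<open>(\<parallel>s\<parallel>\<^sup>2 + \<parallel>q\<parallel>\<^sup>2) / 2\<close>. This costs half of the descent, and the other half has
  to outweigh the part \<open>\<kappa> B\<^sup>2 \<parallel>q\<parallel>\<^sup>2 / 2\<close> of \<open>\<parallel>s\<parallel>\<^sup>2 / 2\<close>: here the bound on \<open>\<kappa> B\<^sup>2\<close> enters.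

  All of this happens pointwise (\<open>robust_step_descent\<close>) and leaves only two kinds of random
  terms besides \<open>q\<close>: inner products \<open>w\<^sub>i \<bullet> n\<^sub>i\<close> in which \<open>w\<^sub>i\<close> is a function of the current iterate, and
  squares \<open>\<parallel>n\<^sub>i\<parallel>\<^sup>2\<close>. Since the sample behind \<open>n\<^sub>i\<close> is independent of the iterate, the former have
  expectation \<open>0\<close> and the latter at most \<open>\<sigma>\<^sup>2\<close> (\<open>oracle_noise\<close>). The Byzantine messages enter
  only through \<open>s\<close>, which the robustness inequality bounds for every single outcome.

  Integrability is carried along the iteration by the values \<open>f (x t)\<close> alone: they are bounded below,
  the step inequality bounds them above, and an \<open>L\<close>-smooth function that is bounded below satisfies
  \<open>\<parallel>q\<parallel>\<^sup>2 \<le> 2 L (f - inf f)\<close> (\<open>gradient_sq_le_gap\<close>). Summing the expected one-step decrease over the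
  rounds telescopes, and dividing by the coefficient of \<open>\<parallel>q\<parallel>\<^sup>2\<close> gives the rate.
\<close>

section \<open>Gradients and smooth functions\<close>

lemma gradient_eqI:
  assumes "GDERIV f x :> v"
  shows "gradient f x = v"
  unfolding gradient_def
proof (rule the_equality)
  fix u assume "GDERIV f x :> u"
  then have "(\<lambda>h. h \<bullet> u) = (\<lambda>h. h \<bullet> v)"
    using assms unfolding gderiv_def by (rule has_derivative_unique)
  then have "\<forall>h. h \<bullet> u = h \<bullet> v"
    by (simp add: fun_eq_iff)
  then show "u = v"
    by (rule iffD1[OF vector_eq_ldot])
qed (fact assms)

text \<open>In finite dimension every linear functional is an inner product with a fixed vector.\<close>

lemma GDERIV_gradient:
  fixes f :: "'a::euclidean_space \<Rightarrow> real"
  assumes "f differentiable (at x)"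
  shows "GDERIV f x :> gradient f x"
proof -
  obtain f' where f': "(f has_derivative f') (at x)"
    using assms by (auto simp: differentiable_def)
  interpret bounded_linear f'
    using f' by (rule has_derivative_bounded_linear)
  have "f' h = h \<bullet> (\<Sum>b\<in>Basis. f' b *\<^sub>R b)" for h
  proof -
    have "f' h = f' (\<Sum>b\<in>Basis. (h \<bullet> b) *\<^sub>R b)"
      by (simp add: euclidean_representation)
    also have "\<dots> = h \<bullet> (\<Sum>b\<in>Basis. f' b *\<^sub>R b)"
      by (simp add: sum scaleR inner_sum_right mult.commute)
    finally show ?thesis .
  qed
  then have "f' = (\<lambda>h. h \<bullet> (\<Sum>b\<in>Basis. f' b *\<^sub>R b))"
    by blast
  then have "GDERIV f x :> (\<Sum>b\<in>Basis. f' b *\<^sub>R b)"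
    using f' unfolding gderiv_def by simp
  moreover from this have "gradient f x = (\<Sum>b\<in>Basis. f' b *\<^sub>R b)"
    by (rule gradient_eqI)
  ultimately show ?thesis
    by simp
qed

lemma gradient_average:
  fixes f :: "'i \<Rightarrow> 'a::euclidean_space \<Rightarrow> real"
  assumes "\<And>i. i \<in> S \<Longrightarrow> f i differentiable (at x)"
  shows "gradient (\<lambda>y. average S (\<lambda>i. f i y)) x = average S (\<lambda>i. gradient (f i) x)"
proof (rule gradient_eqI)
  have "((\<lambda>y. (1 / real (card S)) *\<^sub>R (\<Sum>i\<in>S. f i y)) has_derivative
         (\<lambda>h. (1 / real (card S)) *\<^sub>R (\<Sum>i\<in>S. h \<bullet> gradient (f i) x))) (at x)"
    using GDERIV_gradient[OF assms]
    by (intro has_derivative_scaleR_right has_derivative_sum) (auto simp: gderiv_def)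
  then show "GDERIV (\<lambda>y. average S (\<lambda>i. f i y)) x :> average S (\<lambda>i. gradient (f i) x)"
    by (simp add: gderiv_def average_def inner_sum_right)
qed

text \<open>
  Along the segment from \<open>x\<close> to \<open>y\<close>, the difference of the two sides has derivative
  \<open>(\<nabla>f(x + t d) - \<nabla>f(x)) \<bullet> d - L t \<parallel>d\<parallel>\<^sup>2\<close> with \<open>d = y - x\<close>, which the Lipschitz bound on the gradient
  makes nonpositive.
\<close>

lemma descent_lemma:
  fixes f :: "'a::euclidean_space \<Rightarrow> real"
  assumes "L_smooth L f"
  shows "f y \<le> f x + (y - x) \<bullet> gradient f x + L / 2 * (norm (y - x))\<^sup>2"
proof -
  define d where "d = y - x"
  define \<phi> where "\<phi> t = f (x + t *\<^sub>R d) - t * (d \<bullet> gradient f x) - L * t\<^sup>2 / 2 * (norm d)\<^sup>2" for t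
  have diff: "f differentiable (at z)" and lip: "L-lipschitz_on UNIV (gradient f)" for z
    using assms by (auto simp: L_smooth_def)
  have "\<phi> 1 \<le> \<phi> 0"
  proof (rule DERIV_nonpos_imp_nonincreasing[where f = \<phi>])
    fix t :: real assume t: "0 \<le> t" "t \<le> 1"
    let ?D = "d \<bullet> gradient f (x + t *\<^sub>R d) - d \<bullet> gradient f x - L * t * (norm d)\<^sup>2"
    have 1: "(f has_derivative (\<lambda>h. h \<bullet> gradient f (x + t *\<^sub>R d))) (at (x + t *\<^sub>R d))"
      using GDERIV_gradient[OF diff] by (simp add: gderiv_def)
    have 2: "((\<lambda>t. x + t *\<^sub>R d) has_derivative (\<lambda>h. h *\<^sub>R d)) (at t)"
      by (auto intro!: derivative_eq_intros)
    have "((\<lambda>t. f (x + t *\<^sub>R d)) has_real_derivative (d \<bullet> gradient f (x + t *\<^sub>R d))) (at t)"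
      using has_derivative_compose[OF 2 1] by (simp add: has_field_derivative_def mult_commute_abs)
    then have "(\<phi> has_real_derivative ?D) (at t)"
      unfolding \<phi>_def by (auto intro!: derivative_eq_intros)
    moreover have "?D \<le> 0"
    proof -
      have "d \<bullet> (gradient f (x + t *\<^sub>R d) - gradient f x)
              \<le> norm d * norm (gradient f (x + t *\<^sub>R d) - gradient f x)"
        by (rule norm_cauchy_schwarz)
      also have "\<dots> \<le> norm d * (L * norm (t *\<^sub>R d))"
        using lipschitz_onD[OF lip, of "x + t *\<^sub>R d" x]
        by (intro mult_left_mono) (auto simp: dist_norm)
      finally show ?thesis
        using t by (simp add: inner_diff_right power2_eq_square algebra_simps)
    qed
    ultimately show "\<exists>z. (\<phi> has_real_derivative z) (at t) \<and> z \<le> 0"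
      by blast
  qed simp
  then show ?thesis
    by (simp add: \<phi>_def d_def)
qed

lemma L_smooth_borel_measurable:
  fixes f :: "'a::euclidean_space \<Rightarrow> real"
  assumes "L_smooth L f"
  shows "f \<in> borel_measurable borel" "gradient f \<in> borel_measurable borel"
proof -
  have "continuous_on UNIV f" "continuous_on UNIV (gradient f)"
    using assms by (auto simp: L_smooth_def intro: lipschitz_on_continuous_on
        differentiable_imp_continuous_on differentiable_at_imp_differentiable_on)
  then show "f \<in> borel_measurable borel" "gradient f \<in> borel_measurable borel"
    by (auto intro: borel_measurable_continuous_onI)
qed

text \<open>A gradient step with stepsize \<open>1 / L\<close> cannot take \<open>f\<close> below its infimum.\<close>

lemma gradient_sq_le_gap:
  fixes f :: "'a::euclidean_space \<Rightarrow> real"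
  assumes "L_smooth L f" "bdd_below (range f)"
  shows "(norm (gradient f x))\<^sup>2 \<le> 2 * L * (f x - (INF y. f y))"
proof -
  let ?q = "gradient f x"
  have L: "0 < L"
    using assms by (simp add: L_smooth_def)
  have "(INF y. f y) \<le> f (x - (1 / L) *\<^sub>R ?q)"
    using assms(2) by (rule cINF_lower) simp
  also have "\<dots> \<le> f x - (norm ?q)\<^sup>2 / (2 * L)"
    using descent_lemma[OF assms(1), of "x - (1 / L) *\<^sub>R ?q" x] L
    by (simp add: power_mult_distrib power2_norm_eq_inner[symmetric] field_simps power2_eq_square)
  finally show ?thesis
    using L by (simp add: field_simps)
qed

section \<open>One step of robust descent\<close>

lemma average_add: "average S (\<lambda>i. u i + v i) = average S u + average S v"
  by (simp add: average_def sum.distrib scaleR_right_distrib)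

lemma average_diff: "average S (\<lambda>i. u i - v i) = average S u - average S v"
  by (simp add: average_def sum_subtractf scaleR_right_diff_distrib)

lemma average_mult: "average S (\<lambda>i. c * u i) = c * average S u" for c :: real
  by (simp add: average_def sum_distrib_left[symmetric])

lemma average_inner: "average S (\<lambda>i. c \<bullet> v i) = c \<bullet> average S v"
  by (simp add: average_def inner_sum_right)

lemma average_const: "card S > 0 \<Longrightarrow> average S (\<lambda>i. c) = c"
  by (simp add: average_def sum_constant_scaleR)

text \<open>The decomposition of a mean squared distance into variance and squared bias.\<close>

lemma average_sq_dist:
  fixes v :: "'i \<Rightarrow> 'a::real_inner"
  assumes "card S > 0"
  shows "average S (\<lambda>i. (norm (v i - c))\<^sup>2)
    = average S (\<lambda>i. (norm (v i - average S v))\<^sup>2) + (norm (average S v - c))\<^sup>2"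
proof -
  let ?m = "average S v"
  have "(norm (v i - c))\<^sup>2
      = (norm (v i - ?m))\<^sup>2 + 2 * ((?m - c) \<bullet> (v i - ?m)) + (norm (?m - c))\<^sup>2" for i
    by (simp add: power2_norm_eq_inner algebra_simps inner_commute)
  then show ?thesis
    using assms by (simp add: average_add average_mult average_inner average_diff average_const)
qed

lemma average_sq_nonneg: "0 \<le> average S (\<lambda>i. (norm (v i))\<^sup>2)"
  by (simp add: average_def sum_nonneg)

lemma norm_average_sq_le:
  fixes v :: "'i \<Rightarrow> 'a::real_inner"
  assumes "card S > 0"
  shows "(norm (average S v))\<^sup>2 \<le> average S (\<lambda>i. (norm (v i))\<^sup>2)"
  using average_sq_dist[OF assms, of v 0] average_sq_nonneg[of S "\<lambda>i. v i - average S v"] by simp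

text \<open>
  The random message \<open>v i\<close> of worker \<open>i\<close> is compared with its conditional mean \<open>a i\<close>. The point of the
  form of the bound is that the noise \<open>v i - a i\<close> appears either squared or linearly, in an inner
  product with a vector that the current iterate determines, so that expectations can be taken term
  by term.
\<close>

lemma robust_step_descent:
  fixes f :: "'a::euclidean_space \<Rightarrow> real" and a v :: "'i \<Rightarrow> 'a"
  assumes smooth: "L_smooth L f" and S: "card S > 0"
    and mean: "gradient f x = average S a"
    and dissimilar: "average S (\<lambda>i. (norm (a i - gradient f x))\<^sup>2)
      \<le> G\<^sup>2 + B\<^sup>2 * (norm (gradient f x))\<^sup>2"
    and robust: "(norm (r - average S v))\<^sup>2 \<le> \<kappa> * average S (\<lambda>i. (norm (v i - average S v))\<^sup>2)"
    and "0 \<le> \<kappa>" "0 \<le> \<gamma>"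
  defines "\<beta> \<equiv> (\<gamma> / 2 + L * \<gamma>\<^sup>2) * \<kappa>"
  shows "f (x - \<gamma> *\<^sub>R r) \<le> f x
    - (\<gamma> / 2 - L * \<gamma>\<^sup>2 - \<beta> * B\<^sup>2) * (norm (gradient f x))\<^sup>2 + \<beta> * G\<^sup>2
    + average S (\<lambda>i. ((2 * L * \<gamma>\<^sup>2 - \<gamma>) *\<^sub>R gradient f x + (2 * \<beta>) *\<^sub>R (a i - gradient f x))
        \<bullet> (v i - a i))
    + (\<beta> + L * \<gamma>\<^sup>2) * average S (\<lambda>i. (norm (v i - a i))\<^sup>2)"
proof -
  define q where "q = gradient f x"
  define s where "s = r - average S v"
  define n where "n i = v i - a i" for i
  define N where "N = average S (\<lambda>i. (norm (n i))\<^sup>2)"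
  define X where "X = average S (\<lambda>i. (a i - q) \<bullet> n i)"
  define k where "k = L * \<gamma>\<^sup>2"
  have L: "0 < L"
    using smooth by (simp add: L_smooth_def)
  have k: "0 \<le> k"
    using L by (simp add: k_def)
  have nbar: "average S n = average S v - q"
    by (simp add: n_def[abs_def] average_diff mean q_def)
  then have r: "r = s + q + average S n"
    by (simp add: s_def)
  have nbar_sq: "(norm (average S n))\<^sup>2 \<le> N"
    unfolding N_def by (rule norm_average_sq_le[OF S])

  have "average S (\<lambda>i. (norm (v i - average S v))\<^sup>2) \<le> average S (\<lambda>i. (norm (v i - q))\<^sup>2)"
    using average_sq_dist[OF S, of v q] by simp
  also have "\<dots> = average S (\<lambda>i. (norm (a i - q))\<^sup>2 + 2 * ((a i - q) \<bullet> n i) + (norm (n i))\<^sup>2)"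
    by (rule arg_cong[where f = "average S"])
       (simp add: fun_eq_iff n_def power2_norm_eq_inner algebra_simps inner_commute)
  also have "\<dots> \<le> G\<^sup>2 + B\<^sup>2 * (norm q)\<^sup>2 + 2 * X + N"
    using dissimilar by (simp add: average_add average_mult X_def N_def q_def)
  finally have "\<kappa> * average S (\<lambda>i. (norm (v i - average S v))\<^sup>2)
      \<le> \<kappa> * (G\<^sup>2 + B\<^sup>2 * (norm q)\<^sup>2 + 2 * X + N)"
    by (rule mult_left_mono) fact
  then have "(norm s)\<^sup>2 \<le> \<kappa> * (G\<^sup>2 + B\<^sup>2 * (norm q)\<^sup>2 + 2 * X + N)"
    using robust by (simp add: s_def)
  then have s_sq: "(\<gamma> / 2 + k) * (norm s)\<^sup>2 \<le> \<beta> * (G\<^sup>2 + B\<^sup>2 * (norm q)\<^sup>2 + 2 * X + N)"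
    using mult_left_mono[of _ _ "\<gamma> / 2 + k"] k \<open>0 \<le> \<gamma>\<close> by (simp add: \<beta>_def k_def mult.assoc)

  have "- (s \<bullet> q) \<le> ((norm s)\<^sup>2 + (norm q)\<^sup>2) / 2"
    using zero_le_power2[of "norm (s + q)"]
    by (simp add: power2_norm_eq_inner algebra_simps inner_commute)
  then have rq: "- (r \<bullet> q) \<le> ((norm s)\<^sup>2 - (norm q)\<^sup>2) / 2 - q \<bullet> average S n"
    by (simp add: r inner_add_left inner_add_right power2_norm_eq_inner inner_commute field_simps)
  have "(norm r)\<^sup>2 \<le> 2 * (norm s)\<^sup>2 + 2 * (norm (q + average S n))\<^sup>2"
    using zero_le_power2[of "norm (s - (q + average S n))"]
    by (simp add: r power2_norm_eq_inner algebra_simps inner_commute)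
  also have "\<dots> \<le> 2 * (norm s)\<^sup>2 + 2 * (norm q)\<^sup>2 + 4 * (q \<bullet> average S n) + 2 * N"
    using nbar_sq by (simp add: power2_norm_eq_inner algebra_simps inner_commute)
  finally have r_sq: "(norm r)\<^sup>2 \<le> \<dots>" .

  have "f (x - \<gamma> *\<^sub>R r) \<le> f x + \<gamma> * (- (r \<bullet> q)) + k / 2 * (norm r)\<^sup>2"
    using descent_lemma[OF smooth, of "x - \<gamma> *\<^sub>R r" x]
    by (simp add: q_def k_def power_mult_distrib)
  also have "\<dots> \<le> f x + \<gamma> * (((norm s)\<^sup>2 - (norm q)\<^sup>2) / 2 - q \<bullet> average S n)
      + k / 2 * (2 * (norm s)\<^sup>2 + 2 * (norm q)\<^sup>2 + 4 * (q \<bullet> average S n) + 2 * N)"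
    using mult_left_mono[OF rq \<open>0 \<le> \<gamma>\<close>] mult_left_mono[OF r_sq, of "k / 2"] k by simp
  also have "\<dots> = f x - (\<gamma> / 2 - k) * (norm q)\<^sup>2 + (\<gamma> / 2 + k) * (norm s)\<^sup>2
      + (2 * k - \<gamma>) * (q \<bullet> average S n) + k * N"
    by (simp add: field_simps)
  also have "\<dots> \<le> f x - (\<gamma> / 2 - k) * (norm q)\<^sup>2
      + \<beta> * (G\<^sup>2 + B\<^sup>2 * (norm q)\<^sup>2 + 2 * X + N) + (2 * k - \<gamma>) * (q \<bullet> average S n) + k * N"
    using s_sq by simp
  also have "\<dots> = f x - (\<gamma> / 2 - k - \<beta> * B\<^sup>2) * (norm q)\<^sup>2 + \<beta> * G\<^sup>2
      + ((2 * k - \<gamma>) * (q \<bullet> average S n) + 2 * \<beta> * X) + (\<beta> + k) * N"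
    by (simp add: algebra_simps)
  also have "(2 * k - \<gamma>) * (q \<bullet> average S n) + 2 * \<beta> * X
      = average S (\<lambda>i. ((2 * k - \<gamma>) *\<^sub>R q + (2 * \<beta>) *\<^sub>R (a i - q)) \<bullet> n i)"
    by (simp add: X_def inner_add_left average_add average_mult average_inner)
  finally show ?thesis
    by (simp add: q_def k_def N_def n_def mult.assoc)
qed

section \<open>Noise at a random iterate\<close>

text \<open>
  Independence is expressed by \<open>\<sigma>\<close>-algebras that contain the events of \<open>X\<close> and of \<open>Y\<close>: in the run,
  \<open>A\<close> is the whole past and \<open>B\<close> is generated by all samples of one round, and \<open>X\<close> and \<open>Y\<close> take values
  in different types.
\<close>

lemma (in prob_space) distr_Pair_eq_pair_measure:
  assumes [measurable]: "X \<in> M \<rightarrow>\<^sub>M S" "Y \<in> M \<rightarrow>\<^sub>M T"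
    and indep: "indep_set A B"
    and X: "\<And>U. U \<in> sets S \<Longrightarrow> X -` U \<inter> space M \<in> A"
    and Y: "\<And>V. V \<in> sets T \<Longrightarrow> Y -` V \<inter> space M \<in> B"
  shows "distr M (S \<Otimes>\<^sub>M T) (\<lambda>\<omega>. (X \<omega>, Y \<omega>)) = distr M S X \<Otimes>\<^sub>M distr M T Y"
proof (rule pair_measure_eqI[symmetric])
  interpret X: prob_space "distr M S X" by (rule prob_space_distr) simp
  interpret Y: prob_space "distr M T Y" by (rule prob_space_distr) simp
  show "sigma_finite_measure (distr M S X)" "sigma_finite_measure (distr M T Y)"
    by unfold_locales
  fix U V assume "U \<in> sets (distr M S X)" "V \<in> sets (distr M T Y)"
  then have [measurable]: "U \<in> sets S" "V \<in> sets T"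
    by auto
  have "(\<lambda>\<omega>. (X \<omega>, Y \<omega>)) -` (U \<times> V) \<inter> space M = (X -` U \<inter> space M) \<inter> (Y -` V \<inter> space M)"
    by auto
  moreover have "prob ((X -` U \<inter> space M) \<inter> (Y -` V \<inter> space M))
      = prob (X -` U \<inter> space M) * prob (Y -` V \<inter> space M)"
    using X Y by (intro indep_setD[OF indep]) auto
  ultimately show "emeasure (distr M S X) U * emeasure (distr M T Y) V
      = emeasure (distr M (S \<Otimes>\<^sub>M T) (\<lambda>\<omega>. (X \<omega>, Y \<omega>))) (U \<times> V)"
    by (simp add: emeasure_distr emeasure_eq_measure ennreal_mult)
qed simp

text \<open>
  Since the joint law of the iterate \<open>X\<close> and the sample \<open>Y\<close> is a product measure, Fubini's theorem
  transfers the bounds for the stochastic gradient at each fixed point to the random point \<open>X\<close>.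
\<close>

lemma (in prob_space) oracle_noise:
  fixes \<phi> :: "'b::euclidean_space \<Rightarrow> 'z \<Rightarrow> 'b"
  assumes X[measurable]: "X \<in> borel_measurable M" and Y[measurable]: "Y \<in> M \<rightarrow>\<^sub>M P"
    and "prob_space P"
    and joint: "distr M (borel \<Otimes>\<^sub>M P) (\<lambda>\<omega>. (X \<omega>, Y \<omega>)) = distr M borel X \<Otimes>\<^sub>M P"
    and meas: "(\<lambda>(y, z). \<phi> y z) \<in> borel_measurable (borel \<Otimes>\<^sub>M P)"
    and int: "\<And>y. integrable P (\<phi> y)" and mean: "\<And>y. (\<integral>z. \<phi> y z \<partial>P) = a y"
    and int_sq: "\<And>y. integrable P (\<lambda>z. (norm (\<phi> y z - a y))\<^sup>2)"
    and variance: "\<And>y. (\<integral>z. (norm (\<phi> y z - a y))\<^sup>2 \<partial>P) \<le> \<sigma>\<^sup>2"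
  shows "a \<in> borel_measurable borel"
    and "integrable M (\<lambda>\<omega>. (norm (\<phi> (X \<omega>) (Y \<omega>) - a (X \<omega>)))\<^sup>2)"
    and "expectation (\<lambda>\<omega>. (norm (\<phi> (X \<omega>) (Y \<omega>) - a (X \<omega>)))\<^sup>2) \<le> \<sigma>\<^sup>2"
    and "\<And>w. w \<in> borel_measurable borel \<Longrightarrow> integrable M (\<lambda>\<omega>. (norm (w (X \<omega>)))\<^sup>2) \<Longrightarrow>
      integrable M (\<lambda>\<omega>. w (X \<omega>) \<bullet> (\<phi> (X \<omega>) (Y \<omega>) - a (X \<omega>)))"
    and "\<And>w. w \<in> borel_measurable borel \<Longrightarrow> integrable M (\<lambda>\<omega>. (norm (w (X \<omega>)))\<^sup>2) \<Longrightarrow>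
      expectation (\<lambda>\<omega>. w (X \<omega>) \<bullet> (\<phi> (X \<omega>) (Y \<omega>) - a (X \<omega>))) = 0"
proof -
  have [measurable]: "case_prod \<phi> \<in> borel_measurable (borel \<Otimes>\<^sub>M P)"
    using meas by simp
  interpret P: prob_space P by fact
  interpret X: prob_space "distr M borel X"
    by (rule prob_space_distr) simp
  interpret XP: pair_prob_space "distr M borel X" P ..
  have "(\<lambda>y. \<integral>z. \<phi> y z \<partial>P) \<in> borel_measurable borel"
    by measurable
  then show a[measurable]: "a \<in> borel_measurable borel"
    by (simp add: mean)
  let ?n = "\<lambda>\<omega>. \<phi> (X \<omega>) (Y \<omega>) - a (X \<omega>)"
  have bound: "(\<integral>\<^sup>+\<omega>. ennreal ((norm (?n \<omega>))\<^sup>2) \<partial>M) \<le> ennreal (\<sigma>\<^sup>2)"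
  proof -
    have "(\<integral>\<^sup>+\<omega>. ennreal ((norm (?n \<omega>))\<^sup>2) \<partial>M)
        = (\<integral>\<^sup>+p. (case p of (y, z) \<Rightarrow> ennreal ((norm (\<phi> y z - a y))\<^sup>2))
            \<partial>distr M (borel \<Otimes>\<^sub>M P) (\<lambda>\<omega>. (X \<omega>, Y \<omega>)))"
      by (subst nn_integral_distr) auto
    also have "\<dots> = (\<integral>\<^sup>+y. \<integral>\<^sup>+z. ennreal ((norm (\<phi> y z - a y))\<^sup>2) \<partial>P \<partial>distr M borel X)"
      unfolding joint by (subst P.nn_integral_fst[symmetric]) auto
    also have "\<dots> \<le> (\<integral>\<^sup>+y. ennreal (\<sigma>\<^sup>2) \<partial>distr M borel X)"
      using variance by (intro nn_integral_mono) (simp add: nn_integral_eq_integral[OF int_sq])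
    also have "\<dots> = ennreal (\<sigma>\<^sup>2)"
      using X.emeasure_space_1 by simp
    finally show ?thesis .
  qed
  show sq: "integrable M (\<lambda>\<omega>. (norm (?n \<omega>))\<^sup>2)"
    using bound by (intro integrableI_bounded) (auto intro: le_less_trans)
  show "expectation (\<lambda>\<omega>. (norm (?n \<omega>))\<^sup>2) \<le> \<sigma>\<^sup>2"
    using bound by (simp add: nn_integral_eq_integral[OF sq])
  fix w :: "'b \<Rightarrow> 'b"
  assume w[measurable]: "w \<in> borel_measurable borel"
    and w_sq: "integrable M (\<lambda>\<omega>. (norm (w (X \<omega>)))\<^sup>2)"
  show int_w: "integrable M (\<lambda>\<omega>. w (X \<omega>) \<bullet> ?n \<omega>)"
  proof (rule Bochner_Integration.integrable_bound)
    show "integrable M (\<lambda>\<omega>. (norm (w (X \<omega>)))\<^sup>2 + (norm (?n \<omega>))\<^sup>2)"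
      using w_sq sq by simp
    show "AE \<omega> in M. norm (w (X \<omega>) \<bullet> ?n \<omega>) \<le> norm ((norm (w (X \<omega>)))\<^sup>2 + (norm (?n \<omega>))\<^sup>2)"
    proof (rule AE_I2)
      fix \<omega>
      have "\<bar>w (X \<omega>) \<bullet> ?n \<omega>\<bar> \<le> norm (w (X \<omega>)) * norm (?n \<omega>)"
        by (rule Cauchy_Schwarz_ineq2)
      also have "\<dots> \<le> (norm (w (X \<omega>)))\<^sup>2 + (norm (?n \<omega>))\<^sup>2"
        using sum_squares_bound[of "norm (w (X \<omega>))" "norm (?n \<omega>)"]
          mult_nonneg_nonneg[OF norm_ge_zero[of "w (X \<omega>)"] norm_ge_zero[of "?n \<omega>"]] by linarith
      finally show "norm (w (X \<omega>) \<bullet> ?n \<omega>) \<le> norm ((norm (w (X \<omega>)))\<^sup>2 + (norm (?n \<omega>))\<^sup>2)"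
        by simp
    qed
  qed measurable
  let ?h = "\<lambda>(y, z). w y \<bullet> (\<phi> y z - a y)"
  have "integrable (distr M (borel \<Otimes>\<^sub>M P) (\<lambda>\<omega>. (X \<omega>, Y \<omega>))) ?h"
    using int_w by (subst integrable_distr_eq) auto
  then have int_h: "integrable (distr M borel X \<Otimes>\<^sub>M P) ?h"
    by (simp add: joint)
  have "expectation (\<lambda>\<omega>. w (X \<omega>) \<bullet> ?n \<omega>)
      = (\<integral>p. ?h p \<partial>distr M (borel \<Otimes>\<^sub>M P) (\<lambda>\<omega>. (X \<omega>, Y \<omega>)))"
    by (subst integral_distr) auto
  also have "\<dots> = (\<integral>y. \<integral>z. w y \<bullet> (\<phi> y z - a y) \<partial>P \<partial>distr M borel X)"
    unfolding joint using XP.integral_fst'[OF int_h] by simp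
  also have "\<dots> = 0"
    using int mean by (simp add: P.prob_space)
  finally show "expectation (\<lambda>\<omega>. w (X \<omega>) \<bullet> ?n \<omega>) = 0" .
qed

section \<open>Robust distributed SGD\<close>

lemma (in r_dsgd) measurable_past:
  assumes "f \<in> F s \<rightarrow>\<^sub>M N"
  shows "f \<in> M \<rightarrow>\<^sub>M N"
  using assms past_events[of s] space_F[of s] by (auto simp: measurable_def)

text \<open>The sample of one worker is a component of the tuple of samples, which is independent of the past.\<close>

lemma (in r_dsgd) iterate_sample_joint_law:
  assumes t: "t \<ge> 1" and i: "i \<in> H"
  shows "x (t - 1) \<in> borel_measurable M" "\<xi> t i \<in> M \<rightarrow>\<^sub>M D i"
    and "distr M (borel \<Otimes>\<^sub>M D i) (\<lambda>\<omega>. (x (t - 1) \<omega>, \<xi> t i \<omega>)) = distr M borel (x (t - 1)) \<Otimes>\<^sub>M D i"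
proof -
  show x: "x (t - 1) \<in> borel_measurable M" and \<xi>: "\<xi> t i \<in> M \<rightarrow>\<^sub>M D i"
    using measurable_past[OF iterate_adapted] measurable_past[OF sample_adapted[OF t i]] by auto
  let ?Y = "\<lambda>\<omega>. \<lambda>i\<in>H. \<xi> t i \<omega>"
  have all: "\<xi> t j \<omega> \<in> space (D j)" if "j \<in> H" "\<omega> \<in> space M" for j \<omega>
    using measurable_past[OF sample_adapted[OF t that(1)]] that(2) by (rule measurable_space)
  have Y: "?Y \<in> vimage_algebra (space M) ?Y (Pi\<^sub>M H D) \<rightarrow>\<^sub>M Pi\<^sub>M H D"
    by (rule measurable_vimage_algebra1) (use all in \<open>auto simp: space_PiM\<close>)
  have comp: "(\<lambda>\<omega>. ?Y \<omega> i) \<in> vimage_algebra (space M) ?Y (Pi\<^sub>M H D) \<rightarrow>\<^sub>M D i"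
    using measurable_compose[OF Y measurable_component_singleton[OF i]] .
  have "distr M (borel \<Otimes>\<^sub>M D i) (\<lambda>\<omega>. (x (t - 1) \<omega>, \<xi> t i \<omega>))
      = distr M borel (x (t - 1)) \<Otimes>\<^sub>M distr M (D i) (\<xi> t i)"
    using x \<xi> fresh[OF t]
  proof (rule distr_Pair_eq_pair_measure)
    show "x (t - 1) -` U \<inter> space M \<in> sets (F (t - 1))" if "U \<in> sets borel" for U
      using measurable_sets[OF iterate_adapted that, of "t - 1"] space_F by simp
    show "\<xi> t i -` V \<inter> space M \<in> sets (vimage_algebra (space M) ?Y (Pi\<^sub>M H D))"
      if "V \<in> sets (D i)" for V
      using measurable_sets[OF comp that] i by simp
  qed
  then show "distr M (borel \<Otimes>\<^sub>M D i) (\<lambda>\<omega>. (x (t - 1) \<omega>, \<xi> t i \<omega>))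
      = distr M borel (x (t - 1)) \<Otimes>\<^sub>M D i"
    using sample_law[OF t i] by simp
qed

lemma integrable_gradient_sq:
  fixes f :: "'a::euclidean_space \<Rightarrow> real"
  assumes smooth: "L_smooth L f" and below: "bdd_below (range f)"
    and "finite_measure M" and [measurable]: "X \<in> borel_measurable M"
    and int: "integrable M (\<lambda>\<omega>. f (X \<omega>))"
  shows "integrable M (\<lambda>\<omega>. (norm (gradient f (X \<omega>)))\<^sup>2)"
proof -
  interpret finite_measure M by fact
  have [measurable]: "gradient f \<in> borel_measurable borel"
    using smooth by (rule L_smooth_borel_measurable)
  show ?thesis
  proof (rule Bochner_Integration.integrable_bound)
    show "integrable M (\<lambda>\<omega>. 2 * L * (f (X \<omega>) - (INF y. f y)))"
      using int by simp
    show "AE \<omega> in M. norm ((norm (gradient f (X \<omega>)))\<^sup>2) \<le> norm (2 * L * (f (X \<omega>) - (INF y. f y)))"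
      using gradient_sq_le_gap[OF smooth below] by (intro AE_I2) (smt (verit) real_norm_def zero_le_power2)
  qed measurable
qed

text \<open>
  The expectation of \<open>robust_step_descent\<close>. The first conclusion is what makes the lemma iterable. It
  holds because \<open>f (x t)\<close> lies between the infimum of \<open>f\<close> and the pointwise upper bound, called \<open>U\<close>
  in the proof, which is integrable because it involves only the previous iterate and the honest
  noise.
\<close>

lemma (in r_dsgd) expected_descent:
  fixes f :: "real^'d \<Rightarrow> real" and f\<^sub>i :: "'n \<Rightarrow> real^'d \<Rightarrow> real"
  assumes t: "t \<ge> 1"
    and H: "card H = CARD('n) - b"
    and data: "\<And>i. i \<in> H \<Longrightarrow> prob_space (D i)"
    and smooth: "L_smooth L f" and below: "bdd_below (range f)"
    and mean: "\<And>y. gradient f y = average H (\<lambda>i. gradient (f\<^sub>i i) y)"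
    and dissimilar: "bounded_dissimilarity G B H f\<^sub>i f"
    and orac: "stochastic_first_order_oracle M H D \<xi> f\<^sub>i g \<sigma>"
    and robust: "robust_aggregation b \<kappa> \<A>"
    and int: "integrable M (\<lambda>\<omega>. f (x (t - 1) \<omega>))"
  defines "\<beta> \<equiv> (\<gamma> t / 2 + L * (\<gamma> t)\<^sup>2) * \<kappa>"
  shows "integrable M (\<lambda>\<omega>. f (x t \<omega>))"
    and "expectation (\<lambda>\<omega>. f (x t \<omega>)) \<le> expectation (\<lambda>\<omega>. f (x (t - 1) \<omega>))
      - (\<gamma> t / 2 - L * (\<gamma> t)\<^sup>2 - \<beta> * B\<^sup>2)
          * expectation (\<lambda>\<omega>. (norm (gradient f (x (t - 1) \<omega>)))\<^sup>2)
      + \<beta> * G\<^sup>2 + (\<beta> + L * (\<gamma> t)\<^sup>2) * \<sigma>\<^sup>2"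
proof -
  define X where "X = x (t - 1)"
  define q where "q = gradient f"
  define a where "a i = gradient (f\<^sub>i i)" for i
  define n where "n i \<omega> = g i (X \<omega>) (\<xi> t i \<omega>) - a i (X \<omega>)" for i \<omega>
  define w where "w i y = (2 * L * (\<gamma> t)\<^sup>2 - \<gamma> t) *\<^sub>R q y + (2 * \<beta>) *\<^sub>R (a i y - q y)" for i y
  define C where "C = \<gamma> t / 2 - L * (\<gamma> t)\<^sup>2 - \<beta> * B\<^sup>2"
  define U where "U \<omega> = f (X \<omega>) - C * (norm (q (X \<omega>)))\<^sup>2 + \<beta> * G\<^sup>2
      + average H (\<lambda>i. w i (X \<omega>) \<bullet> n i \<omega>)
      + (\<beta> + L * (\<gamma> t)\<^sup>2) * average H (\<lambda>i. (norm (n i \<omega>))\<^sup>2)" for \<omega>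
  have L: "0 < L"
    using smooth by (simp add: L_smooth_def)
  have \<kappa>: "0 < \<kappa>" and b: "2 * b < CARD('n)"
    using robust by (auto simp: robust_aggregation_def)
  have cardH: "card H > 0"
    using H b by simp
  have avgH: "average H u = (\<Sum>i\<in>H. u i) / real (CARD('n) - b)" for u :: "'n \<Rightarrow> real"
    by (simp add: average_def flip: H)
  have \<gamma>: "0 \<le> \<gamma> t"
    using stepsize_pos[OF t] by simp
  have \<beta>: "0 \<le> \<beta>"
    using L \<kappa> \<gamma> by (simp add: \<beta>_def)
  have x_meas: "x s \<in> borel_measurable M" for s
    using iterate_adapted by (rule measurable_past)
  then have X[measurable]: "X \<in> borel_measurable M"
    by (simp add: X_def)
  have f[measurable]: "f \<in> borel_measurable borel" and q[measurable]: "q \<in> borel_measurable borel"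
    unfolding q_def using smooth by (fact L_smooth_borel_measurable)+
  have int_q: "integrable M (\<lambda>\<omega>. (norm (q (X \<omega>)))\<^sup>2)"
    unfolding q_def using smooth below finite_measure_axioms X int[folded X_def]
    by (rule integrable_gradient_sq)

  have step: "f (x t \<omega>) \<le> U \<omega>" if \<omega>: "\<omega> \<in> space M" for \<omega>
  proof -
    have avg: "average H (\<lambda>i. h (m t \<omega> $ i) i) = average H (\<lambda>i. h (g i (X \<omega>) (\<xi> t i \<omega>)) i)"
      for h :: "real^'d \<Rightarrow> 'n \<Rightarrow> 'y::real_vector"
      using honest_message[OF t _ \<omega>] by (simp add: average_def X_def)
    have "x t \<omega> = X \<omega> - \<gamma> t *\<^sub>R \<A> (m t \<omega>)"
      using server_update[OF t \<omega>] by (simp add: X_def)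
    moreover have "f (X \<omega> - \<gamma> t *\<^sub>R \<A> (m t \<omega>)) \<le> f (X \<omega>)
        - C * (norm (q (X \<omega>)))\<^sup>2 + \<beta> * G\<^sup>2
        + average H (\<lambda>i. w i (X \<omega>) \<bullet> (m t \<omega> $ i - a i (X \<omega>)))
        + (\<beta> + L * (\<gamma> t)\<^sup>2) * average H (\<lambda>i. (norm (m t \<omega> $ i - a i (X \<omega>)))\<^sup>2)"
      unfolding C_def w_def q_def \<beta>_def
    proof (rule robust_step_descent[OF smooth cardH])
      show "gradient f (X \<omega>) = average H (\<lambda>i. a i (X \<omega>))"
        by (simp add: mean a_def)
      show "average H (\<lambda>i. (norm (a i (X \<omega>) - gradient f (X \<omega>)))\<^sup>2)
          \<le> G\<^sup>2 + B\<^sup>2 * (norm (gradient f (X \<omega>)))\<^sup>2"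
        using dissimilar by (simp add: bounded_dissimilarity_def a_def)
      show "(norm (\<A> (m t \<omega>) - average H (($) (m t \<omega>))))\<^sup>2
          \<le> \<kappa> * average H (\<lambda>i. (norm (m t \<omega> $ i - average H (($) (m t \<omega>))))\<^sup>2)"
        using robust H by (simp add: robust_aggregation_def avgH del: of_nat_diff)
    qed (use \<kappa> \<gamma> in auto)
    ultimately show ?thesis
      using avg[of "\<lambda>v i. w i (X \<omega>) \<bullet> (v - a i (X \<omega>))"]
        avg[of "\<lambda>v i. (norm (v - a i (X \<omega>)))\<^sup>2"]
      by (simp add: U_def n_def)
  qed

  have sq: "integrable M (\<lambda>\<omega>. (norm (n i \<omega>))\<^sup>2)" "expectation (\<lambda>\<omega>. (norm (n i \<omega>))\<^sup>2) \<le> \<sigma>\<^sup>2"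
    and cross: "integrable M (\<lambda>\<omega>. w i (X \<omega>) \<bullet> n i \<omega>)" "expectation (\<lambda>\<omega>. w i (X \<omega>) \<bullet> n i \<omega>) = 0"
    if i: "i \<in> H" for i
  proof -
    note law = iterate_sample_joint_law[OF t i]
    have o1: "(\<lambda>(y, z). g i y z) \<in> borel_measurable (borel \<Otimes>\<^sub>M D i)"
      and o2: "integrable (D i) (g i y)" and o3: "(\<integral>z. g i y z \<partial>D i) = a i y"
      and o4: "integrable (D i) (\<lambda>z. (norm (g i y z - a i y))\<^sup>2)"
      and o5: "(\<integral>z. (norm (g i y z - a i y))\<^sup>2 \<partial>D i) \<le> \<sigma>\<^sup>2" for y
      using orac i by (auto simp: stochastic_first_order_oracle_def a_def)
    note noise = oracle_noise[OF law(1,2) data[OF i] law(3) o1 o2 o3 o4 o5,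
        folded X_def, folded n_def]
    show "integrable M (\<lambda>\<omega>. (norm (n i \<omega>))\<^sup>2)" "expectation (\<lambda>\<omega>. (norm (n i \<omega>))\<^sup>2) \<le> \<sigma>\<^sup>2"
      using noise(2,3) .
    have [measurable]: "a i \<in> borel_measurable borel"
      by (rule noise(1))
    have w[measurable]: "w i \<in> borel_measurable borel"
      unfolding w_def by measurable
    \<comment> \<open>The dissimilarity bound controls the mean over \<open>H\<close>, hence each summand up to the factor \<open>card H\<close>.\<close>
    have dev: "(norm (a i y - q y))\<^sup>2 \<le> real (card H) * (G\<^sup>2 + B\<^sup>2 * (norm (q y))\<^sup>2)" for y
    proof -
      have "(norm (a i y - q y))\<^sup>2 \<le> (\<Sum>j\<in>H. (norm (a j y - q y))\<^sup>2)"
        using i by (intro member_le_sum) auto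
      also have "\<dots> = real (card H) * average H (\<lambda>j. (norm (a j y - q y))\<^sup>2)"
        using cardH by (simp add: average_def)
      also have "\<dots> \<le> real (card H) * (G\<^sup>2 + B\<^sup>2 * (norm (q y))\<^sup>2)"
        using dissimilar by (intro mult_left_mono) (auto simp: bounded_dissimilarity_def a_def q_def)
      finally show ?thesis .
    qed
    define c where "c = 2 * L * (\<gamma> t)\<^sup>2 - \<gamma> t"
    define W where "W y = 2 * c\<^sup>2 * (norm (q y))\<^sup>2
      + 2 * (2 * \<beta>)\<^sup>2 * (real (card H) * (G\<^sup>2 + B\<^sup>2 * (norm (q y))\<^sup>2))" for y
    have w_le: "(norm (w i y))\<^sup>2 \<le> W y" for y
    proof -
      have "(norm (w i y))\<^sup>2 \<le> 2 * (norm (c *\<^sub>R q y))\<^sup>2 + 2 * (norm ((2 * \<beta>) *\<^sub>R (a i y - q y)))\<^sup>2"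
        using zero_le_power2[of "norm (c *\<^sub>R q y - (2 * \<beta>) *\<^sub>R (a i y - q y))"]
        unfolding w_def c_def[symmetric] power2_norm_eq_inner inner_add_left inner_add_right
          inner_diff_left inner_diff_right by (simp add: inner_commute)
      also have "\<dots> = 2 * c\<^sup>2 * (norm (q y))\<^sup>2 + 2 * (2 * \<beta>)\<^sup>2 * (norm (a i y - q y))\<^sup>2"
        by (simp add: power_mult_distrib)
      also have "\<dots> \<le> W y"
        unfolding W_def using dev[of y] by (intro add_left_mono mult_left_mono) auto
      finally show ?thesis .
    qed
    have w_sq: "integrable M (\<lambda>\<omega>. (norm (w i (X \<omega>)))\<^sup>2)"
    proof (rule Bochner_Integration.integrable_bound)
      show "integrable M (\<lambda>\<omega>. W (X \<omega>))"
        unfolding W_def using int_q by simp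
      show "AE \<omega> in M. norm ((norm (w i (X \<omega>)))\<^sup>2) \<le> norm (W (X \<omega>))"
        using w_le by (intro AE_I2) (smt (verit) real_norm_def zero_le_power2)
    qed measurable
    show "integrable M (\<lambda>\<omega>. w i (X \<omega>) \<bullet> n i \<omega>)" "expectation (\<lambda>\<omega>. w i (X \<omega>) \<bullet> n i \<omega>) = 0"
      using noise(4,5)[OF w w_sq] .
  qed

  have int_cross: "integrable M (\<lambda>\<omega>. average H (\<lambda>i. w i (X \<omega>) \<bullet> n i \<omega>))"
    and int_sq: "integrable M (\<lambda>\<omega>. average H (\<lambda>i. (norm (n i \<omega>))\<^sup>2))"
    using cross(1) sq(1) by (auto simp: average_def)
  have int_U: "integrable M U"
    unfolding U_def using int int_q int_cross int_sq by (simp add: X_def)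
  show int_new: "integrable M (\<lambda>\<omega>. f (x t \<omega>))"
  proof (rule Bochner_Integration.integrable_bound)
    show "integrable M (\<lambda>\<omega>. \<bar>U \<omega>\<bar> + \<bar>INF y. f y\<bar>)"
      using int_U by simp
    show "AE \<omega> in M. norm (f (x t \<omega>)) \<le> norm (\<bar>U \<omega>\<bar> + \<bar>INF y. f y\<bar>)"
    proof (rule AE_I2)
      fix \<omega> assume "\<omega> \<in> space M"
      then have "f (x t \<omega>) \<le> U \<omega>" "(INF y. f y) \<le> f (x t \<omega>)"
        using step below by (auto intro: cINF_lower)
      then show "norm (f (x t \<omega>)) \<le> norm (\<bar>U \<omega>\<bar> + \<bar>INF y. f y\<bar>)"
        by simp
    qed
    show "(\<lambda>\<omega>. f (x t \<omega>)) \<in> borel_measurable M"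
      using x_meas[of t] f by (rule measurable_compose)
  qed
  have "expectation (\<lambda>\<omega>. f (x t \<omega>)) \<le> expectation U"
    using int_new int_U step by (intro integral_mono) auto
  also have "\<dots> = expectation (\<lambda>\<omega>. f (X \<omega>)) - C * expectation (\<lambda>\<omega>. (norm (q (X \<omega>)))\<^sup>2) + \<beta> * G\<^sup>2
      + expectation (\<lambda>\<omega>. average H (\<lambda>i. w i (X \<omega>) \<bullet> n i \<omega>))
      + (\<beta> + L * (\<gamma> t)\<^sup>2) * expectation (\<lambda>\<omega>. average H (\<lambda>i. (norm (n i \<omega>))\<^sup>2))"
    unfolding U_def using int int_q int_cross int_sq by (simp add: X_def prob_space)
  also have "expectation (\<lambda>\<omega>. average H (\<lambda>i. w i (X \<omega>) \<bullet> n i \<omega>)) = 0"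
    using cross by (simp add: average_def Bochner_Integration.integral_sum)
  also have "expectation (\<lambda>\<omega>. average H (\<lambda>i. (norm (n i \<omega>))\<^sup>2)) \<le> \<sigma>\<^sup>2"
  proof -
    have "(\<Sum>i\<in>H. expectation (\<lambda>\<omega>. (norm (n i \<omega>))\<^sup>2)) \<le> real (card H) * \<sigma>\<^sup>2"
      using sq(2) by (rule sum_bounded_above)
    then show ?thesis
      using sq(1) cardH by (simp add: average_def Bochner_Integration.integral_sum field_simps)
  qed
  finally show "expectation (\<lambda>\<omega>. f (x t \<omega>)) \<le> expectation (\<lambda>\<omega>. f (x (t - 1) \<omega>))
      - (\<gamma> t / 2 - L * (\<gamma> t)\<^sup>2 - \<beta> * B\<^sup>2)
          * expectation (\<lambda>\<omega>. (norm (gradient f (x (t - 1) \<omega>)))\<^sup>2)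
      + \<beta> * G\<^sup>2 + (\<beta> + L * (\<gamma> t)\<^sup>2) * \<sigma>\<^sup>2"
    using \<beta> L by (simp add: C_def q_def X_def mult_left_mono)
qed

section \<open>The rate\<close>

text \<open>
  The assumption on \<open>u = \<kappa> B\<^sup>2\<close> is equivalent to \<open>1 - u - 2 \<delta> (1 + u) > (1 + 2 \<delta>) (1 - u) / 3\<close>, and
  \<open>L \<gamma> \<le> \<delta>\<close> makes the left side a lower bound for the coefficient of the squared gradient, up to the
  factor \<open>\<gamma> / 2\<close>.
\<close>

lemma descent_coefficient_bound:
  fixes \<gamma> L \<delta> u :: real
  assumes \<gamma>: "0 \<le> \<gamma>" "L * \<gamma> \<le> \<delta>" and "0 < \<delta>" "0 \<le> u" "u < (1 - 4 * \<delta>) / (1 + 2 * \<delta>)"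
  shows "\<gamma> * (1 + 2 * \<delta>) * (1 - u) / 6 \<le> \<gamma> / 2 - L * \<gamma>\<^sup>2 - (\<gamma> / 2 + L * \<gamma>\<^sup>2) * u"
proof -
  have "u * (1 + 2 * \<delta>) < 1 - 4 * \<delta>"
    using assms by (simp add: pos_less_divide_eq)
  then have "(1 + 2 * \<delta>) * (1 - u) / 6 \<le> (1 - u) / 2 - \<delta> * (1 + u)"
    by (simp add: field_simps)
  also have "\<dots> \<le> (1 - u) / 2 - (L * \<gamma>) * (1 + u)"
    using assms by (intro diff_left_mono mult_right_mono) auto
  finally have "\<gamma> * ((1 + 2 * \<delta>) * (1 - u) / 6) \<le> \<gamma> * ((1 - u) / 2 - (L * \<gamma>) * (1 + u))"
    using \<gamma>(1) by (rule mult_left_mono)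
  then show ?thesis
    by (simp add: algebra_simps power2_eq_square)
qed

text \<open>
  The telescoped inequality, solved for the sum \<open>S\<close> of the expected squared gradients. With
  \<open>\<gamma> = \<gamma>\<^sub>0 / sqrt T\<close> both \<open>1 / (T \<gamma>)\<close> and \<open>\<gamma>\<close> are of order \<open>1 / sqrt T\<close>.
\<close>

lemma rate_from_telescoped_descent:
  fixes T :: nat and S \<Delta> V K L \<delta> \<gamma>\<^sub>0 p :: real
  assumes T: "T \<ge> 1" and "0 < \<gamma>\<^sub>0" "0 < L" "0 < \<delta>" "0 < p" "0 \<le> \<Delta>" "0 \<le> V" "0 \<le> K"
  defines "\<gamma> \<equiv> \<gamma>\<^sub>0 / sqrt (real T)"
  assumes tel: "\<gamma> * (1 + 2 * \<delta>) * p / 6 * S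
    \<le> \<Delta> + real T * (\<gamma> * (1 / 2 + \<delta>) * K + L * \<gamma>\<^sup>2 * V)"
  shows "1 / real T * S \<le> rate_constant L \<delta> \<gamma>\<^sub>0 * ((\<Delta> + V) / (p * sqrt (real T)) + K / p)"
proof -
  define r where "r = sqrt (real T)"
  define e where "e = 1 + 2 * \<delta>"
  have r: "0 < r" "real T = r * r"
    using T by (auto simp: r_def)
  have e: "0 < e" "1 / 2 + \<delta> = e / 2"
    using \<open>0 < \<delta>\<close> by (auto simp: e_def)
  have "S / (r * r) = 6 / (\<gamma>\<^sub>0 * e * p * r) * (\<gamma>\<^sub>0 / r * e * p / 6 * S)"
    using r(1) e(1) \<open>0 < \<gamma>\<^sub>0\<close> \<open>0 < p\<close> by (simp add: field_simps)
  also have "\<dots> \<le> 6 / (\<gamma>\<^sub>0 * e * p * r)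
      * (\<Delta> + r * r * (\<gamma>\<^sub>0 / r * (e / 2) * K + L * (\<gamma>\<^sub>0 / r)\<^sup>2 * V))"
    using tel[unfolded \<gamma>_def, folded r_def e_def, unfolded r(2) e(2)]
      r(1) e(1) \<open>0 < \<gamma>\<^sub>0\<close> \<open>0 < p\<close> by (intro mult_left_mono) auto
  also have "\<dots> = 6 / e * (1 / \<gamma>\<^sub>0) * (\<Delta> / (p * r)) + 6 / e * (L * \<gamma>\<^sub>0) * (V / (p * r))
      + 3 * (K / p)"
    using r(1) e(1) \<open>0 < \<gamma>\<^sub>0\<close> \<open>0 < p\<close> by (simp add: field_simps power2_eq_square)
  also have "\<dots> \<le> rate_constant L \<delta> \<gamma>\<^sub>0 * (\<Delta> / (p * r)) + rate_constant L \<delta> \<gamma>\<^sub>0 * (V / (p * r))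
      + rate_constant L \<delta> \<gamma>\<^sub>0 * (K / p)"
  proof (intro add_mono mult_right_mono)
    have "6 / e * (1 / \<gamma>\<^sub>0) \<le> 6 / e * max (1 / \<gamma>\<^sub>0) (L * \<gamma>\<^sub>0)"
      "6 / e * (L * \<gamma>\<^sub>0) \<le> 6 / e * max (1 / \<gamma>\<^sub>0) (L * \<gamma>\<^sub>0)"
      using e(1) by (intro mult_left_mono; simp)+
    then show "6 / e * (1 / \<gamma>\<^sub>0) \<le> rate_constant L \<delta> \<gamma>\<^sub>0" "6 / e * (L * \<gamma>\<^sub>0) \<le> rate_constant L \<delta> \<gamma>\<^sub>0"
      unfolding rate_constant_def e_def by linarith+
    show "3 \<le> rate_constant L \<delta> \<gamma>\<^sub>0"
      by (simp add: rate_constant_def)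
  qed (use r assms in auto)
  finally show ?thesis
    using r(1) by (simp add: r(2) r_def[symmetric] add_divide_distrib distrib_left)
qed

theorem corollary3p2:
  fixes l :: "real^'d \<Rightarrow> 'z \<Rightarrow> real"
    and D :: "'n::finite \<Rightarrow> 'z measure"
    and g :: "'n \<Rightarrow> real^'d \<Rightarrow> 'z \<Rightarrow> real^'d"
    and \<A> :: "real^'d^'n \<Rightarrow> real^'d"
    and H :: "'n set"
    and M :: "'w measure"
    and F :: "nat \<Rightarrow> 'w measure"
    and \<xi> :: "nat \<Rightarrow> 'n \<Rightarrow> 'w \<Rightarrow> 'z"
    and m :: "nat \<Rightarrow> 'w \<Rightarrow> real^'d^'n"
    and x :: "nat \<Rightarrow> 'w \<Rightarrow> real^'d"
    and x0 :: "real^'d"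
    and b T :: nat
    and L G B \<sigma> \<kappa> \<delta> \<gamma>\<^sub>0 :: real
  assumes byzantine: "2 * b < CARD('n)"
    and honest: "card H = CARD('n) - b"
    and data: "\<And>i. i \<in> H \<Longrightarrow> prob_space (D i)"
    and loss_integrable: "\<And>i y. i \<in> H \<Longrightarrow> integrable (D i) (l y)"
    and local_differentiable:
      "\<And>i y. i \<in> H \<Longrightarrow> local_objective l (D i) differentiable (at y)"
    and bounded_below: "bdd_below (range (global_objective l D H))"
    and smooth: "L_smooth L (global_objective l D H)"
    and dissimilarity:
      "bounded_dissimilarity G B H (\<lambda>i. local_objective l (D i)) (global_objective l D H)"
    and orac: "stochastic_first_order_oracle M H D \<xi> (\<lambda>i. local_objective l (D i)) g \<sigma>"
    and robust: "robust_aggregation b \<kappa> \<A>"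
    and delta: "0 < \<delta>" "\<delta> < 1 / 4"
    and kappa_B: "\<kappa> * B\<^sup>2 < (1 - 4 * \<delta>) / (1 + 2 * \<delta>)"
    and T: "T \<ge> 1"
    and gamma0: "0 < \<gamma>\<^sub>0" "\<gamma>\<^sub>0 \<le> \<delta> / L"
    and run: "r_dsgd M F H D \<xi> g \<A> (\<lambda>_. \<gamma>\<^sub>0 / sqrt (real T)) x0 m x"
  shows "(\<forall>t<T. integrable M (\<lambda>\<omega>. (norm (gradient (global_objective l D H) (x t \<omega>)))\<^sup>2)) \<and>
    1 / real T *
        (\<Sum>t<T. \<integral>\<omega>. (norm (gradient (global_objective l D H) (x t \<omega>)))\<^sup>2 \<partial>M)
      \<le> rate_constant L \<delta> \<gamma>\<^sub>0 *
          ((global_objective l D H x0 - (INF y. global_objective l D H y) + \<sigma>\<^sup>2)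
              / ((1 - \<kappa> * B\<^sup>2) * sqrt (real T))
            + \<kappa> * G\<^sup>2 / (1 - \<kappa> * B\<^sup>2)
            + \<kappa> * \<sigma>\<^sup>2 / (1 - \<kappa> * B\<^sup>2))"
proof -
  define f where "f = global_objective l D H"
  define \<gamma> where "\<gamma> = \<gamma>\<^sub>0 / sqrt (real T)"
  define K where "K = G\<^sup>2 + \<sigma>\<^sup>2"
  define p where "p = 1 - \<kappa> * B\<^sup>2"
  define E where "E t = (\<integral>\<omega>. f (x t \<omega>) \<partial>M)" for t
  define Q where "Q t = (\<integral>\<omega>. (norm (gradient f (x t \<omega>)))\<^sup>2 \<partial>M)" for t
  define c where "c = \<gamma> * (1 + 2 * \<delta>) * p / 6"
  define e where "e = \<gamma> * (1 / 2 + \<delta>) * (\<kappa> * K) + L * \<gamma>\<^sup>2 * \<sigma>\<^sup>2"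
  interpret r_dsgd M F H D \<xi> g \<A> "\<lambda>_. \<gamma>" x0 m x
    using run by (simp add: \<gamma>_def)
  have smooth_f: "L_smooth L f" and below: "bdd_below (range f)"
    using smooth bounded_below by (auto simp: f_def)
  have L: "0 < L"
    using smooth_f by (simp add: L_smooth_def)
  have \<kappa>: "0 < \<kappa>"
    using robust by (simp add: robust_aggregation_def)
  have K: "0 \<le> K"
    by (simp add: K_def)
  have u: "0 \<le> \<kappa> * B\<^sup>2"
    using \<kappa> by simp
  have \<gamma>: "0 < \<gamma>"
    using gamma0 T by (simp add: \<gamma>_def)
  have "\<gamma> \<le> \<gamma>\<^sub>0"
    using gamma0 T by (simp add: \<gamma>_def divide_le_eq)
  then have L\<gamma>: "L * \<gamma> \<le> \<delta>"
    using gamma0(2) L by (simp add: field_simps) (smt (verit) mult_left_mono)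
  have "(1 - 4 * \<delta>) / (1 + 2 * \<delta>) < 1"
    using delta by (simp add: divide_less_eq)
  then have p: "0 < p"
    using kappa_B by (simp add: p_def)
  have mean: "gradient f y = average H (\<lambda>i. gradient (local_objective l (D i)) y)" for y
    unfolding f_def global_objective_def
    using local_differentiable by (intro gradient_average) auto

  note step = expected_descent[OF _ honest data smooth_f below mean dissimilarity[folded f_def]
      orac robust]
  have int_f: "integrable M (\<lambda>\<omega>. f (x t \<omega>))" for t
  proof (induction t)
    case 0
    have "integrable M (\<lambda>\<omega>. f x0)"
      by simp
    then show ?case
      by (rule iffD1[OF Bochner_Integration.integrable_cong, rotated -1]) (auto simp: initial)
  next
    case (Suc t)
    then show ?case
      using step(1)[of "Suc t"] by simp
  qed
  have x_meas: "x t \<in> borel_measurable M" for t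
    using iterate_adapted by (rule measurable_past)
  have int_Q: "integrable M (\<lambda>\<omega>. (norm (gradient f (x t \<omega>)))\<^sup>2)" for t
    using smooth_f below finite_measure_axioms x_meas int_f by (rule integrable_gradient_sq)
  have Q_nonneg: "0 \<le> Q t" for t
    by (simp add: Q_def)

  have one: "E (Suc t) \<le> E t - c * Q t + e" for t
  proof -
    let ?\<beta> = "(\<gamma> / 2 + L * \<gamma>\<^sup>2) * \<kappa>"
    have "E (Suc t) \<le> E t - (\<gamma> / 2 - L * \<gamma>\<^sup>2 - ?\<beta> * B\<^sup>2) * Q t + ?\<beta> * G\<^sup>2 + (?\<beta> + L * \<gamma>\<^sup>2) * \<sigma>\<^sup>2"
      using step(2)[of "Suc t"] int_f[of t] by (simp add: E_def Q_def)
    moreover have "c * Q t \<le> (\<gamma> / 2 - L * \<gamma>\<^sup>2 - ?\<beta> * B\<^sup>2) * Q t"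
      using descent_coefficient_bound[of \<gamma> L \<delta> "\<kappa> * B\<^sup>2"] \<gamma> L\<gamma> delta u kappa_B Q_nonneg
      by (intro mult_right_mono) (auto simp: c_def p_def mult.assoc)
    moreover have "?\<beta> * K \<le> \<gamma> * (1 / 2 + \<delta>) * (\<kappa> * K)"
    proof -
      have "\<gamma> / 2 + L * \<gamma>\<^sup>2 \<le> \<gamma> * (1 / 2 + \<delta>)"
        using mult_left_mono[OF L\<gamma>, of \<gamma>] \<gamma> by (simp add: algebra_simps power2_eq_square)
      then have "(\<gamma> / 2 + L * \<gamma>\<^sup>2) * (\<kappa> * K) \<le> \<gamma> * (1 / 2 + \<delta>) * (\<kappa> * K)"
        using \<kappa> K by (intro mult_right_mono) auto
      then show ?thesis
        by (simp add: mult.assoc)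
    qed
    ultimately show ?thesis
      by (simp add: e_def K_def algebra_simps)
  qed
  have telescope: "c * (\<Sum>t<N. Q t) \<le> E 0 - E N + real N * e" for N
  proof (induction N)
    case (Suc N)
    then show ?case
      using one[of N] by (simp add: algebra_simps)
  qed simp
  have "E 0 = (\<integral>\<omega>. f x0 \<partial>M)"
    unfolding E_def by (rule Bochner_Integration.integral_cong) (auto simp: initial)
  then have E0: "E 0 = f x0"
    by (simp add: prob_space)
  have "(\<integral>\<omega>. (INF y. f y) \<partial>M) \<le> E T"
    unfolding E_def using int_f below by (intro integral_mono) (auto intro: cINF_lower)
  then have ET: "(INF y. f y) \<le> E T"
    by (simp add: prob_space)
  have "1 / real T * (\<Sum>t<T. Q t) \<le> rate_constant L \<delta> \<gamma>\<^sub>0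
      * ((f x0 - (INF y. f y) + \<sigma>\<^sup>2) / (p * sqrt (real T)) + \<kappa> * K / p)"
  proof (rule rate_from_telescoped_descent[OF T gamma0(1) L delta(1) p])
    show "0 \<le> f x0 - (INF y. f y)"
      using below by (simp add: cINF_lower)
    show "\<gamma>\<^sub>0 / sqrt (real T) * (1 + 2 * \<delta>) * p / 6 * (\<Sum>t<T. Q t)
        \<le> f x0 - (INF y. f y) + real T * (\<gamma>\<^sub>0 / sqrt (real T) * (1 / 2 + \<delta>) * (\<kappa> * K)
            + L * (\<gamma>\<^sub>0 / sqrt (real T))\<^sup>2 * \<sigma>\<^sup>2)"
      using telescope[of T] E0 ET by (simp add: c_def e_def \<gamma>_def[symmetric])
  qed (use \<kappa> K in auto)
  then show ?thesis
    using int_Q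
    by (simp add: Q_def f_def p_def K_def distrib_left add_divide_distrib add.assoc)
qed

end
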